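(* Let $V_1,\ldots,V_k$ be subsemimodules of $\mathbf{R}_{\max,\mathrm{m}}^n$ that are closed in the Euclidean topology, and write $P_i=P_{V_i}$ for the projector onto $V_i$. Then the Hilbert value $d_{\mathrm H}(V_1,\ldots,V_k)$ is the spectral radius of $P_k\cdots P_1$. The spectrum of $P_k\cdots P_1$ is the set of Hilbert values $d_{\mathrm H}(V_1^M,\ldots,V_k^M)$, where $M$ ranges over all nonempty subsets of $\{1,\ldots,n\}$.
   Context: $\mathbf{R}_{\max,\mathrm{m}}$ is the max-times semiring: the set $\mathbf{R}_+$ of nonnegative reals with addition $a\oplus b=\max(a,b)$ and the usual multiplication. $\mathbf{R}_{\max,\mathrm{m}}^n$ is $\mathbf{R}_+^n$ with entrywise $\oplus$ and scalar multiplication, ordered entrywise. A subsemimodule is a subset containing $0$ and closed under $\oplus$ and under multiplication by scalars from $\mathbf{R}_+$. For a closed subsemimodule $V$, the projector onto $V$ is $P_V(x)=\max\{u\in V\mid u\le x\}$, $x\in\mathbf{R}_+^n$ (the maximum exists). For a map $F:\mathbf{R}_+^n\to\mathbf{R}_+^n$, the spectrum is the set of $\lambda\in\mathbf{R}_+$ for which there is $x\in\mathbf{R}_+^n\setminus\{0\}$ with $Fx=\lambda x$; the spectral radius is the maximal element of the spectrum (for compositions of projectors onto closed subsemimodules, the spectrum is nonempty and finite). For $x,y\in\mathbf{R}_+^n$, $y\ne0$: $x/y=\max\{\lambda\ge0\mid\lambda y\le x\}=\min_{i:\,y_i\ne0}x_i/y_i$. The Hilbert value of nonzero vectors is $d_{\mathrm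 H}(x^1,\ldots,x^k)=(x^1/x^2)(x^2/x^3)\cdots(x^{k-1}/x^k)(x^k/x^1)$. The Hilbert value of subsemimodules is $d_{\mathrm H}(V_1,\ldots,V_k)=\sup d_{\mathrm H}(x^1,\ldots,x^k)$ over nonzero $x^1\in V_1,\ldots,x^k\in V_k$, the supremum of the empty set being $0$. $\operatorname{supp}(x)=\{i\mid x_i\ne0\}$, and for $M\subseteq\{1,\ldots,n\}$, $V^M=\{x\in V\mid\operatorname{supp}(x)\subseteq M\}$. *)

theory Defs
  imports "HOL-Analysis.Analysis"
begin

definition nonneg_orthant :: "(real ^ 'n) set" where
  "nonneg_orthant = {x. 0 \<le> x}"

text \<open>On \<open>real ^ 'n\<close> the library order \<open>\<le>\<close> and the supremum \<open>sup\<close> are entrywise, so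
  \<open>sup\<close> is the max-times addition.\<close>

definition subsemimodule :: "(real ^ 'n) set \<Rightarrow> bool" where
  "subsemimodule V \<longleftrightarrow>
     V \<subseteq> nonneg_orthant \<and> 0 \<in> V \<and>
     (\<forall>x\<in>V. \<forall>y\<in>V. sup x y \<in> V) \<and>
     (\<forall>c\<ge>0. \<forall>x\<in>V. c *\<^sub>R x \<in> V)"

definition projector :: "(real ^ 'n) set \<Rightarrow> real ^ 'n \<Rightarrow> real ^ 'n" where
  "projector V x = (GREATEST u. u \<in> V \<and> u \<le> x)"

text \<open>\<open>cyclic_projector V k\<close> is the composition \<open>projector (V k) \<circ> \<dots> \<circ> projector (V 1)\<close>;
  the value \<open>V 0\<close> is not used.\<close>

primrec cyclic_projector :: "(nat \<Rightarrow> (real ^ 'n) set) \<Rightarrow> nat \<Rightarrow> real ^ 'n \<Rightarrow> real ^ 'n" where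
  "cyclic_projector V 0 = id"
| "cyclic_projector V (Suc m) = projector (V (Suc m)) \<circ> cyclic_projector V m"

definition spectrum :: "(real ^ 'n \<Rightarrow> real ^ 'n) \<Rightarrow> real set" where
  "spectrum F = {c. 0 \<le> c \<and> (\<exists>x\<in>nonneg_orthant. x \<noteq> 0 \<and> F x = c *\<^sub>R x)}"

text \<open>A predicate rather than a function, so that existence of the maximum is part of any
  claim about it.\<close>

definition is_spectral_radius :: "(real ^ 'n \<Rightarrow> real ^ 'n) \<Rightarrow> real \<Rightarrow> bool" where
  "is_spectral_radius F r \<longleftrightarrow> r \<in> spectrum F \<and> (\<forall>c\<in>spectrum F. c \<le> r)"

definition vquot :: "real ^ 'n \<Rightarrow> real ^ 'n \<Rightarrow> real" where
  "vquot x y = (GREATEST c. 0 \<le> c \<and> c *\<^sub>R y \<le> x)"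

lemma vquot_eq_Min:
  fixes x y :: "real ^ 'n"
  assumes "0 \<le> x" "0 \<le> y" "y \<noteq> 0"
  shows "vquot x y = Min {x $ i / y $ i | i. y $ i \<noteq> 0}"
proof -
  let ?S = "{x $ i / y $ i | i. y $ i \<noteq> 0}"
  have fin: "finite ?S" by simp
  from \<open>y \<noteq> 0\<close> obtain j where "y $ j \<noteq> 0" by (auto simp: vec_eq_iff)
  then have ne: "?S \<noteq> {}" by blast
  have x0: "0 \<le> x $ i" and y0: "0 \<le> y $ i" for i
    using assms by (auto simp: less_eq_vec_def)
  have le_iff: "c *\<^sub>R y \<le> x \<longleftrightarrow> c \<le> Min ?S" for c
  proof -
    have "c * y $ i \<le> x $ i \<longleftrightarrow> (y $ i \<noteq> 0 \<longrightarrow> c \<le> x $ i / y $ i)" for i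
      using x0[of i] y0[of i] by (cases "y $ i = 0") (auto simp: pos_le_divide_eq)
    then have "c *\<^sub>R y \<le> x \<longleftrightarrow> (\<forall>s\<in>?S. c \<le> s)"
      by (auto simp: less_eq_vec_def)
    then show ?thesis using fin ne by simp
  qed
  have "0 \<le> Min ?S"
    using x0 y0 fin ne by (auto intro!: Min.boundedI)
  then show ?thesis
    unfolding vquot_def le_iff by (intro Greatest_equality) auto
qed

definition hilbert_value :: "nat \<Rightarrow> (nat \<Rightarrow> real ^ 'n) \<Rightarrow> real" where
  "hilbert_value k x = (\<Prod>i\<in>{1..<k}. vquot (x i) (x (Suc i))) * vquot (x k) (x 1)"

text \<open>The values \<open>hilbert_value k x\<close> below are bounded above by \<open>1\<close>, so the real supremum
  is meaningful whenever the set is nonempty.\<close>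

definition hilbert_value_modules :: "nat \<Rightarrow> (nat \<Rightarrow> (real ^ 'n) set) \<Rightarrow> real" where
  "hilbert_value_modules k V =
     (let D = {hilbert_value k x | x. \<forall>i\<in>{1..k}. x i \<in> V i \<and> x i \<noteq> 0}
      in if D = {} then 0 else Sup D)"

definition vsupp :: "real ^ 'n \<Rightarrow> 'n set" where
  "vsupp x = {i. x $ i \<noteq> 0}"

definition restrict_supp :: "(real ^ 'n) set \<Rightarrow> 'n set \<Rightarrow> (real ^ 'n) set" where
  "restrict_supp V M = {x \<in> V. vsupp x \<subseteq> M}"

end

theory Submission
  imports Defs
begin

text \<open>Write \<open>F = P\<^sub>k \<cdots> P\<^sub>1\<close>, a monotone, homogeneous and decreasing map. Nonzero vectors
  \<open>x\<^sup>i \<in> V\<^sub>i\<close> of Hilbert value \<open>c\<close> satisfy \<open>F x\<^sup>k \<ge> c x\<^sup>k\<close>, and comparing \<open>x\<^sup>k\<close> with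
  any \<open>y\<close> such that \<open>F y \<le> \<lambda> y\<close> and \<open>supp x\<^sup>k \<subseteq> supp y\<close> gives \<open>c \<le> \<lambda>\<close>. Conversely, if
  \<open>F x = \<lambda> x\<close>, the successive projections of \<open>x\<close> have Hilbert value at least \<open>\<lambda>\<close>. Hence an
  eigenvector \<open>x\<close> belongs to the eigenvalue \<open>d\<^sub>H(V\<^sub>1\<^sup>M, \<dots>, V\<^sub>k\<^sup>M)\<close> with \<open>M = supp x\<close>.
  To realise this value for a given \<open>M\<close>, Brouwer's theorem yields normalised solutions of
  \<open>F x + \<epsilon> 1\<^sub>M = \<lambda>\<^sub>\<epsilon> x\<close>. They are positive on \<open>M\<close>, so \<open>\<lambda>\<^sub>\<epsilon>\<close> bounds the Hilbert value from above;
  a limit point for \<open>\<epsilon> \<rightarrow> 0\<close> is an eigenvector supported in \<open>M\<close>.\<close>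

subsection \<open>Quotients of vectors\<close>

text \<open>The quotient is a minimum over finitely many coordinates, so some coordinate attains it.
  Comparison arguments need this index, where the scaled \<open>y\<close> touches
  \<open>x\<close>.\<close>

lemma vquot_least:
  fixes x y :: "real ^ 'n"
  assumes "0 \<le> x" "0 \<le> y" "y \<noteq> 0"
  obtains i where "y $ i \<noteq> 0" "vquot x y = x $ i / y $ i" "\<And>j. y $ j \<noteq> 0 \<Longrightarrow> vquot x y \<le> x $ j / y $ j"
proof -
  let ?S = "{x $ i / y $ i | i. y $ i \<noteq> 0}"
  have "finite ?S" by simp
  moreover from \<open>y \<noteq> 0\<close> obtain j where "y $ j \<noteq> 0" by (auto simp: vec_eq_iff)
  then have "?S \<noteq> {}" by blast
  ultimately have "Min ?S \<in> ?S" by (rule Min_in)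
  then obtain i where i: "y $ i \<noteq> 0" "Min ?S = x $ i / y $ i" by auto
  have "Min ?S \<le> x $ j / y $ j" if "y $ j \<noteq> 0" for j
    using that \<open>finite ?S\<close> by (intro Min_le) auto
  with i show thesis
    using vquot_eq_Min[OF assms] by (intro that[of i]) simp_all
qed

lemma vquot_nonneg:
  fixes x y :: "real ^ 'n"
  assumes "0 \<le> x" "0 \<le> y" "y \<noteq> 0"
  shows "0 \<le> vquot x y"
  using assms by (auto simp: less_eq_vec_def intro: vquot_least[OF assms])

lemma vquot_scaleR_le:
  fixes x y :: "real ^ 'n"
  assumes "0 \<le> x" "0 \<le> y" "y \<noteq> 0"
  shows "vquot x y *\<^sub>R y \<le> x"
proof -
  have le: "vquot x y \<le> x $ j / y $ j" if "y $ j \<noteq> 0" for j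
    using that vquot_least[OF assms] by blast
  have "vquot x y * y $ j \<le> x $ j" for j
    using le[of j] assms by (cases "y $ j = 0") (auto simp: less_eq_vec_def pos_le_divide_eq order_less_le)
  then show ?thesis by (simp add: less_eq_vec_def)
qed

text \<open>With \<open>vquot_scaleR_le\<close> this makes division by \<open>y\<close> the residual
  of scaling \<open>y\<close>.\<close>

lemma le_vquot:
  fixes x y :: "real ^ 'n"
  assumes "0 \<le> x" "0 \<le> y" "y \<noteq> 0" "c *\<^sub>R y \<le> x"
  shows "c \<le> vquot x y"
proof -
  obtain i where i: "y $ i \<noteq> 0" "vquot x y = x $ i / y $ i"
    using vquot_least[OF assms(1-3)] by blast
  have "0 < y $ i" "c * y $ i \<le> x $ i"
    using i assms by (auto simp: less_eq_vec_def order_less_le)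
  with i show ?thesis by (simp add: pos_le_divide_eq)
qed

lemma scaleR_vec_mono:
  fixes x y :: "real ^ 'n"
  assumes "0 \<le> c" "x \<le> y"
  shows "c *\<^sub>R x \<le> c *\<^sub>R y"
  using assms by (simp add: less_eq_vec_def mult_left_mono)

lemma vsupp_mono:
  fixes x y :: "real ^ 'n"
  assumes "0 \<le> x" "x \<le> y"
  shows "vsupp x \<subseteq> vsupp y"
  using assms unfolding vsupp_def less_eq_vec_def by (smt (verit) Collect_mono zero_index)

subsection \<open>Faces of the standard simplex\<close>

text \<open>Serves as the perturbation that forces full support on \<open>M\<close>, and as a test
  vector with support \<open>M\<close>.\<close>

definition indicator_vec :: "'n set \<Rightarrow> real ^ 'n" where
  "indicator_vec M = (\<chi> i. if i \<in> M then 1 else 0)"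

lemma indicator_vec_nonneg [simp]: "0 \<le> indicator_vec M"
  by (simp add: indicator_vec_def less_eq_vec_def)

lemma vsupp_indicator_vec [simp]: "vsupp (indicator_vec M) = M"
  by (auto simp: indicator_vec_def vsupp_def)

text \<open>A compact convex domain for Brouwer's theorem. Normalising the coordinate sum keeps
  limit points away from \<open>0\<close>.\<close>

definition simplex_face :: "'n set \<Rightarrow> (real ^ 'n) set" where
  "simplex_face M = {x. 0 \<le> x \<and> vsupp x \<subseteq> M \<and> (\<Sum>i\<in>UNIV. x $ i) = 1}"

lemma simplex_face_subset: "simplex_face M \<subseteq> {0..1::real ^ 'n}"
proof
  fix x :: "real ^ 'n" assume "x \<in> simplex_face M"
  then show "x \<in> {0..1}"
    using member_le_sum[of _ UNIV "\<lambda>i. x $ i"] by (simp add: simplex_face_def less_eq_vec_def)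
qed

lemma simplex_face_nonzero: "x \<in> simplex_face M \<Longrightarrow> x \<noteq> 0"
  by (auto simp: simplex_face_def)

lemma compact_simplex_face: "compact (simplex_face M :: (real ^ 'n) set)"
proof -
  have "simplex_face M = {0..1} \<inter> ((\<Inter>i\<in>-M. {x. x $ i = 0}) \<inter> {x :: real ^ 'n. (\<Sum>i\<in>UNIV. x $ i) = 1})"
    using simplex_face_subset[of M] by (auto simp: simplex_face_def vsupp_def)
  moreover have "closed {x :: real ^ 'n. (\<Sum>i\<in>UNIV. x $ i) = 1}" "closed {x :: real ^ 'n. x $ i = 0}" for i
    by (intro closed_Collect_eq continuous_intros)+
  ultimately show ?thesis
    by (auto intro!: compact_Int_closed closed_Int closed_INT simp: interval_cbox_cart)
qed

lemma convex_simplex_face: "convex (simplex_face M :: (real ^ 'n) set)"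
proof (rule convexI)
  fix x y :: "real ^ 'n" and u v :: real
  assume "x \<in> simplex_face M" "y \<in> simplex_face M" and uv: "0 \<le> u" "0 \<le> v" "u + v = 1"
  then have xy: "0 \<le> x $ i" "0 \<le> y $ i" "i \<notin> M \<Longrightarrow> x $ i = 0" "i \<notin> M \<Longrightarrow> y $ i = 0"
    and sum: "(\<Sum>i\<in>UNIV. x $ i) = 1" "(\<Sum>i\<in>UNIV. y $ i) = 1" for i
    by (auto simp: simplex_face_def less_eq_vec_def vsupp_def)
  have "(\<Sum>i\<in>UNIV. (u *\<^sub>R x + v *\<^sub>R y) $ i) = 1"
    using uv sum by (simp add: sum.distrib sum_distrib_left[symmetric])
  moreover have "vsupp (u *\<^sub>R x + v *\<^sub>R y) \<subseteq> M"
    using xy by (fastforce simp: vsupp_def)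
  ultimately show "u *\<^sub>R x + v *\<^sub>R y \<in> simplex_face M"
    using uv xy by (simp add: simplex_face_def less_eq_vec_def)
qed

lemma axis_in_simplex_face:
  assumes "j \<in> M"
  shows "axis j 1 \<in> simplex_face M"
  using assms by (auto simp: simplex_face_def less_eq_vec_def vsupp_def axis_def)

subsection \<open>Projectors\<close>

text \<open>Compactness of the part of \<open>V\<close> between \<open>0\<close> and
  \<open>x\<close> provides the maximum, without which \<open>GREATEST\<close> would carry no
  information. These three properties characterise the projector.\<close>

lemma projector_greatest:
  fixes V :: "(real ^ 'n) set"
  assumes V: "subsemimodule V" "closed V" and x: "0 \<le> x"
  shows "projector V x \<in> V" "projector V x \<le> x" "\<And>u. u \<in> V \<Longrightarrow> u \<le> x \<Longrightarrow> u \<le> projector V x"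
proof -
  let ?K = "V \<inter> {0..x}"
  have "compact ?K"
    using V by (simp add: closed_Int_compact interval_cbox_cart)
  moreover have "0 \<in> ?K"
    using V x by (simp add: subsemimodule_def)
  moreover have "continuous_on ?K (\<lambda>u. \<Sum>i\<in>UNIV. u $ i)"
    by (intro continuous_intros)
  \<comment> \<open>A maximiser of the coordinate sum is the greatest element, by closure under \<open>sup\<close>.\<close>
  ultimately obtain w where w: "w \<in> ?K" "\<And>u. u \<in> ?K \<Longrightarrow> (\<Sum>i\<in>UNIV. u $ i) \<le> (\<Sum>i\<in>UNIV. w $ i)"
    using continuous_attains_sup[of ?K "\<lambda>u. \<Sum>i\<in>UNIV. u $ i"] by blast
  have great: "u \<le> w" if u: "u \<in> V" "u \<le> x" for u
  proof -
    have "sup w u \<in> ?K"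
      using V u w(1) by (auto simp: subsemimodule_def intro: le_supI1)
    then have "(\<Sum>i\<in>UNIV. sup w u $ i) \<le> (\<Sum>i\<in>UNIV. w $ i)" by (rule w)
    moreover have le: "w $ i \<le> sup w u $ i" for i
      using sup_ge1[of w u] by (simp add: less_eq_vec_def)
    ultimately have "(\<Sum>i\<in>UNIV. w $ i) = (\<Sum>i\<in>UNIV. sup w u $ i)"
      using sum_mono[of UNIV "\<lambda>i. w $ i" "\<lambda>i. sup w u $ i"] by simp
    then have "w $ i = sup w u $ i" for i
      using sum_mono_inv[of "\<lambda>i. w $ i" UNIV "\<lambda>i. sup w u $ i" i] le by simp
    then have "w = sup w u" by (simp add: vec_eq_iff)
    then show ?thesis by (metis sup_ge2)
  qed
  have "projector V x = w"
    unfolding projector_def using w great by (intro Greatest_equality) auto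
  with w great show "projector V x \<in> V" "projector V x \<le> x" "\<And>u. u \<in> V \<Longrightarrow> u \<le> x \<Longrightarrow> u \<le> projector V x"
    by auto
qed

lemma projector_nonneg:
  assumes "subsemimodule V" "closed V" "0 \<le> x"
  shows "0 \<le> projector V x"
  using projector_greatest(3)[OF assms, of 0] assms by (simp add: subsemimodule_def)

lemma projector_mono:
  assumes "subsemimodule V" "closed V" "0 \<le> x" "x \<le> y"
  shows "projector V x \<le> projector V y"
proof -
  have "0 \<le> y" using assms by order
  then show ?thesis
    using projector_greatest[of V] assms by (meson order_trans)
qed

text \<open>The left-hand side is an element of \<open>V\<close> below \<open>c *\<^sub>R x\<close>,
  hence a competitor for the maximum on the right.\<close>

lemma projector_scaleR_ge:
  assumes "subsemimodule V" "closed V" "0 \<le> x" "0 \<le> c"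
  shows "c *\<^sub>R projector V x \<le> projector V (c *\<^sub>R x)"
proof -
  have "0 \<le> c *\<^sub>R x"
    using assms scaleR_vec_mono[of c 0 x] by simp
  moreover have "c *\<^sub>R projector V x \<in> V"
    using assms projector_greatest(1)[of V x] by (simp add: subsemimodule_def)
  moreover have "c *\<^sub>R projector V x \<le> c *\<^sub>R x"
    using assms by (intro scaleR_vec_mono projector_greatest)
  ultimately show ?thesis
    using assms by (intro projector_greatest(3))
qed

section \<open>Continuity of projectors on the unit cube\<close>

text \<open>The factor \<open>t < 1\<close> leaves room at coordinates where \<open>x\<close> is
  positive; where \<open>x\<close> vanishes, nonnegativity of \<open>f n\<close> is enough.\<close>

lemma eventually_scaleR_le:
  fixes x :: "real ^ 'n"
  assumes "f \<longlonglongrightarrow> x" "\<And>n. 0 \<le> f n" "t < 1" "0 \<le> x"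
  shows "\<forall>\<^sub>F n in sequentially. t *\<^sub>R x \<le> f n"
proof -
  have "\<forall>\<^sub>F n in sequentially. t * x $ i \<le> f n $ i" for i
  proof (cases "x $ i = 0")
    case True
    then show ?thesis using assms by (simp add: less_eq_vec_def)
  next
    case False
    then have "t * x $ i < x $ i"
      using assms by (simp add: less_eq_vec_def order_less_le)
    with tendsto_vec_nth[OF assms(1), of i]
    have "\<forall>\<^sub>F n in sequentially. t * x $ i < f n $ i" by (rule order_tendstoD)
    then show ?thesis by eventually_elim simp
  qed
  then have "\<forall>\<^sub>F n in sequentially. \<forall>i. t * x $ i \<le> f n $ i"
    by (simp add: eventually_all_finite)
  then show ?thesis by (simp add: less_eq_vec_def)
qed

text \<open>A map from the cube into the compact cube is continuous once its graph is closed, so it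
  remains to identify the limit of the projections.\<close>

lemma continuous_on_projector:
  fixes V :: "(real ^ 'n) set"
  assumes V: "subsemimodule V" "closed V"
  shows "continuous_on {0..1} (projector V)"
proof (rule continuous_from_closed_graph)
  show "compact {0..1::real ^ 'n}" by (simp add: interval_cbox_cart)
  show "projector V \<in> {0..1} \<rightarrow> {0..1}"
    using projector_nonneg[OF V] projector_greatest(2)[OF V] by (fastforce intro: order_trans)
  show "closed ((\<lambda>x. (x, projector V x)) ` {0..1})"
    unfolding closed_sequential_limits
  proof (intro allI impI, elim conjE)
    fix h and l :: "(real ^ 'n) \<times> (real ^ 'n)"
    assume graph: "\<forall>n. h n \<in> (\<lambda>x. (x, projector V x)) ` {0..1}" and lim: "h \<longlonglongrightarrow> l"
    define f where "f = (\<lambda>n. fst (h n))"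
    obtain x u where l: "l = (x, u)" by (cases l)
    have f: "f n \<in> {0..1}" and h: "h n = (f n, projector V (f n))" for n
      using graph[rule_format, of n] by (auto simp: f_def)
    have fx: "f \<longlonglongrightarrow> x"
      using tendsto_fst[OF lim] by (simp add: l f_def)
    have Pu: "(\<lambda>n. projector V (f n)) \<longlonglongrightarrow> u"
      using tendsto_snd[OF lim] by (simp add: l h)
    have x: "x \<in> {0..1}"
      using closed_sequentially[OF _ _ fx, of "{0..1}"] f by (simp add: interval_cbox_cart closed_cbox)
    have f0: "0 \<le> f n" for n using f[of n] by simp
    have x0: "0 \<le> x" using x by simp
    \<comment> \<open>Membership in the closed set \<open>V\<close> and the bound by
      \<open>x\<close> survive the limit, so \<open>u\<close> competes for the maximum at
      \<open>x\<close>.\<close>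
    have "u \<in> V"
      using closed_sequentially[OF V(2) _ Pu] projector_greatest(1)[OF V f0] by blast
    moreover have "u $ i \<le> x $ i" for i
      using projector_greatest(2)[OF V f0] tendsto_vec_nth[OF Pu] tendsto_vec_nth[OF fx]
      by (intro LIMSEQ_le[of "\<lambda>n. projector V (f n) $ i" _ "\<lambda>n. f n $ i"]) (auto simp: less_eq_vec_def)
    then have "u \<le> x" by (simp add: less_eq_vec_def)
    ultimately have "u \<le> projector V x" using V x0 by (intro projector_greatest(3))
    \<comment> \<open>For the reverse bound, \<open>x\<close> is shrunk by \<open>t < 1\<close> so
      that it lies below \<open>f n\<close> eventually. Homogeneity and monotonicity carry this to
      the projections; then \<open>n\<close> tends to infinity and \<open>t\<close> to
      \<open>1\<close>.\<close>
    moreover have "projector V x $ i \<le> u $ i" for i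
    proof (rule field_le_mult_one_interval)
      fix t :: real assume t: "0 < t" "t < 1"
      have "\<forall>\<^sub>F n in sequentially. t *\<^sub>R x \<le> f n"
        using eventually_scaleR_le[OF fx f0 t(2) x0] .
      then have "\<forall>\<^sub>F n in sequentially. t * projector V x $ i \<le> projector V (f n) $ i"
      proof eventually_elim
        case (elim n)
        have "t *\<^sub>R projector V x \<le> projector V (t *\<^sub>R x)"
          using V x0 t by (intro projector_scaleR_ge) auto
        also have "\<dots> \<le> projector V (f n)"
          using V x0 t elim scaleR_vec_mono[of t 0 x] by (intro projector_mono) auto
        finally show ?case by (simp add: less_eq_vec_def)
      qed
      with tendsto_vec_nth[OF Pu] show "t * projector V x $ i \<le> u $ i"
        by (rule tendsto_lowerbound) simp
    qed
    then have "projector V x \<le> u" by (simp add: less_eq_vec_def)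
    ultimately have "u = projector V x" by (rule antisym)
    with x l show "l \<in> (\<lambda>x. (x, projector V x)) ` {0..1}" by auto
  qed
qed

subsection \<open>Cyclic projectors\<close>

locale closed_subsemimodules =
  fixes V :: "nat \<Rightarrow> (real ^ 'n) set" and k :: nat
  assumes k: "1 \<le> k"
    and sub: "\<And>i. i \<in> {1..k} \<Longrightarrow> subsemimodule (V i)"
    and clo: "\<And>i. i \<in> {1..k} \<Longrightarrow> closed (V i)"
begin

lemma nonneg: "x \<in> V i \<Longrightarrow> i \<in> {1..k} \<Longrightarrow> 0 \<le> x"
  using sub[of i] by (auto simp: subsemimodule_def nonneg_orthant_def)

lemma cyclic_projector_nonneg:
  assumes "m \<le> k" "0 \<le> x"
  shows "0 \<le> cyclic_projector V m x"
  using assms by (induction m) (auto intro!: projector_nonneg sub clo)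

lemma cyclic_projector_Suc_le:
  assumes "m < k" "0 \<le> x"
  shows "cyclic_projector V (Suc m) x \<le> cyclic_projector V m x"
  using assms by (auto intro!: projector_greatest(2) sub clo cyclic_projector_nonneg)

lemma cyclic_projector_antimono:
  assumes "i \<le> j" "j \<le> k" "0 \<le> x"
  shows "cyclic_projector V j x \<le> cyclic_projector V i x"
  using assms
proof (induction j rule: dec_induct)
  case (step m)
  then show ?case using cyclic_projector_Suc_le[of m x] by (meson Suc_leD Suc_le_lessD order_trans)
qed simp

lemma cyclic_projector_le:
  assumes "m \<le> k" "0 \<le> x"
  shows "cyclic_projector V m x \<le> x"
  using cyclic_projector_antimono[of 0 m x] assms by simp

lemma cyclic_projector_in:
  assumes "i \<in> {1..k}" "0 \<le> x"
  shows "cyclic_projector V i x \<in> V i"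
proof (cases i)
  case (Suc m)
  with assms show ?thesis by (auto intro!: projector_greatest(1) sub clo cyclic_projector_nonneg)
qed (use assms in simp)

lemma cyclic_projector_mono:
  assumes "m \<le> k" "0 \<le> x" "x \<le> y"
  shows "cyclic_projector V m x \<le> cyclic_projector V m y"
  using assms by (induction m) (auto intro!: projector_mono sub clo cyclic_projector_nonneg)

lemma cyclic_projector_scaleR_ge:
  assumes "m \<le> k" "0 \<le> x" "0 \<le> c"
  shows "c *\<^sub>R cyclic_projector V m x \<le> cyclic_projector V m (c *\<^sub>R x)"
  using assms
proof (induction m)
  case (Suc m)
  let ?y = "cyclic_projector V m x"
  have V: "subsemimodule (V (Suc m))" "closed (V (Suc m))" and y: "0 \<le> ?y"
    using Suc by (auto intro!: sub clo cyclic_projector_nonneg)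
  have "c *\<^sub>R projector (V (Suc m)) ?y \<le> projector (V (Suc m)) (c *\<^sub>R ?y)"
    using V y Suc by (intro projector_scaleR_ge)
  also have "\<dots> \<le> projector (V (Suc m)) (cyclic_projector V m (c *\<^sub>R x))"
    using V y Suc scaleR_vec_mono[of c 0 ?y] by (intro projector_mono) auto
  finally show ?case by simp
qed simp

lemma continuous_on_cyclic_projector:
  assumes "m \<le> k"
  shows "continuous_on {0..1} (cyclic_projector V m)"
  using assms
proof (induction m)
  case (Suc m)
  \<comment> \<open>The composition decreases vectors, so the cube is invariant and continuity on it
    composes.\<close>
  have "cyclic_projector V m ` {0..1} \<subseteq> {0..1}"
    using Suc cyclic_projector_nonneg[of m] cyclic_projector_le[of m] by (fastforce intro: order_trans)
  moreover have "continuous_on {0..1} (projector (V (Suc m)))"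
    using Suc by (intro continuous_on_projector sub clo) auto
  ultimately show ?case
    using Suc by (auto intro!: continuous_on_compose intro: continuous_on_subset simp del: o_apply)
qed (simp add: id_def)

section \<open>Comparison of Hilbert values with eigenvalues\<close>

lemma hilbert_value_nonneg:
  assumes "\<And>i. i \<in> {1..k} \<Longrightarrow> x i \<in> V i \<and> x i \<noteq> 0"
  shows "0 \<le> hilbert_value k x"
proof -
  have "0 \<le> vquot (x i) (x j)" if "i \<in> {1..k}" "j \<in> {1..k}" for i j
    using that assms nonneg by (intro vquot_nonneg) blast+
  then show ?thesis
    unfolding hilbert_value_def using k by (intro mult_nonneg_nonneg prod_nonneg ballI) auto
qed

text \<open>Going once around the cycle from \<open>x k\<close>, each projection costs at most one
  quotient: a multiple of the next vector that fits below the current iterate also lies below its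
  projection.\<close>

lemma hilbert_value_sub_eigenvector:
  assumes x: "\<And>i. i \<in> {1..k} \<Longrightarrow> x i \<in> V i \<and> x i \<noteq> 0"
  shows "hilbert_value k x *\<^sub>R x k \<le> cyclic_projector V k (x k)"
proof -
  have x0: "0 \<le> x i" if "i \<in> {1..k}" for i using that x nonneg by blast
  have xk: "0 \<le> x k" using x0 k by simp
  have q0: "0 \<le> vquot (x i) (x j)" if "i \<in> {1..k}" "j \<in> {1..k}" for i j
    using that x x0 by (intro vquot_nonneg) auto
  have project: "(a * vquot z (x (Suc m))) *\<^sub>R x (Suc m) \<le> cyclic_projector V (Suc m) (x k)"
    if m: "Suc m \<le> k" and a: "0 \<le> a" and z: "0 \<le> z" "a *\<^sub>R z \<le> cyclic_projector V m (x k)"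
    for a z m
  proof -
    let ?q = "vquot z (x (Suc m))"
    have m': "Suc m \<in> {1..k}" using m by simp
    have q: "0 \<le> ?q" using m' x x0 z by (intro vquot_nonneg) auto
    have "a *\<^sub>R (?q *\<^sub>R x (Suc m)) \<le> a *\<^sub>R z"
      using m' x x0 z a by (intro scaleR_vec_mono vquot_scaleR_le) auto
    also note z(2)
    finally have le: "(a * ?q) *\<^sub>R x (Suc m) \<le> cyclic_projector V m (x k)" by simp
    have "(a * ?q) *\<^sub>R x (Suc m) \<in> V (Suc m)"
      using sub[OF m'] x[OF m'] a q by (simp add: subsemimodule_def)
    then show ?thesis
      using le m sub[OF m'] clo[OF m'] xk by (auto intro!: projector_greatest(3) cyclic_projector_nonneg)
  qed
  \<comment> \<open>The chain starts at \<open>x k\<close>, so the closing quotient of the Hilbert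
    value enters first; for \<open>m = 1\<close> the product over \<open>i\<close> is empty.\<close>
  have "((\<Prod>i\<in>{1..<m}. vquot (x i) (x (Suc i))) * vquot (x k) (x 1)) *\<^sub>R x m
      \<le> cyclic_projector V m (x k)" if "1 \<le> m" "m \<le> k" for m
    using that
  proof (induction m rule: dec_induct)
    case base
    then show ?case using project[of 0 1 "x k"] k xk by simp
  next
    case (step m)
    let ?p = "(\<Prod>i\<in>{1..<m}. vquot (x i) (x (Suc i))) * vquot (x k) (x 1)"
    have "0 \<le> ?p"
      using step k by (intro mult_nonneg_nonneg prod_nonneg ballI q0) auto
    then have "(?p * vquot (x m) (x (Suc m))) *\<^sub>R x (Suc m) \<le> cyclic_projector V (Suc m) (x k)"
      using step x0[of m] by (intro project) auto
    with \<open>1 \<le> m\<close> show ?case by (simp add: mult_ac)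
  qed
  from this[of k] k show ?thesis by (simp add: hilbert_value_def)
qed

text \<open>A Collatz-Wielandt comparison: scale \<open>y\<close> by the largest \<open>b\<close>
  with \<open>b y\<close> below \<open>x\<close>. Then \<open>b c y\<close> is below the image of
  \<open>b y\<close>, which is below that of \<open>x\<close> and thus below \<open>l x\<close>. At
  a coordinate where \<open>b y\<close> touches \<open>x\<close>, positive by the support condition,
  this reads \<open>c \<le> l\<close>.\<close>

lemma sub_eigenvalue_le_super_eigenvalue:
  assumes x: "0 \<le> x" "cyclic_projector V k x \<le> l *\<^sub>R x"
    and y: "0 \<le> y" "y \<noteq> 0" "c *\<^sub>R y \<le> cyclic_projector V k y"
    and supp: "vsupp y \<subseteq> vsupp x"
  shows "c \<le> l"
proof -
  obtain i where i: "y $ i \<noteq> 0" "vquot x y = x $ i / y $ i"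
    using vquot_least[OF x(1) y(1,2)] by blast
  let ?b = "vquot x y"
  have pos: "0 < y $ i" "0 < x $ i"
    using i(1) supp x y by (auto simp: vsupp_def less_eq_vec_def order_less_le)
  have b: "0 \<le> ?b" using x y by (intro vquot_nonneg)
  have "?b *\<^sub>R (c *\<^sub>R y) \<le> ?b *\<^sub>R cyclic_projector V k y"
    using b y by (intro scaleR_vec_mono)
  also have "\<dots> \<le> cyclic_projector V k (?b *\<^sub>R y)"
    using b y by (intro cyclic_projector_scaleR_ge) auto
  also have "\<dots> \<le> cyclic_projector V k x"
    using x y b scaleR_vec_mono[of ?b 0 y] by (intro cyclic_projector_mono vquot_scaleR_le) auto
  also note x(2)
  finally have "?b * (c * y $ i) \<le> l * x $ i" by (simp add: less_eq_vec_def mult.assoc)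
  moreover have "?b * y $ i = x $ i" using i by simp
  ultimately have "c * x $ i \<le> l * x $ i" by (metis mult.left_commute)
  with pos show ?thesis by simp
qed

lemma hilbert_value_le:
  assumes "0 \<le> x" "cyclic_projector V k x \<le> l *\<^sub>R x"
    and "\<And>i. i \<in> {1..k} \<Longrightarrow> y i \<in> restrict_supp (V i) (vsupp x) \<and> y i \<noteq> 0"
  shows "hilbert_value k y \<le> l"
  using assms k hilbert_value_sub_eigenvector[of y] nonneg[of "y k" k]
  by (intro sub_eigenvalue_le_super_eigenvalue[of x l "y k"]) (auto simp: restrict_supp_def)

text \<open>The assumption \<open>0 \<le> l\<close> covers the value \<open>0\<close> assigned to an
  empty set of tuples.\<close>

lemma hilbert_value_modules_le:
  assumes "0 \<le> x" "cyclic_projector V k x \<le> l *\<^sub>R x" "0 \<le> l"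
  shows "hilbert_value_modules k (\<lambda>i. restrict_supp (V i) (vsupp x)) \<le> l"
  unfolding hilbert_value_modules_def Let_def
  using assms hilbert_value_le[OF assms(1,2)] by (auto intro!: cSup_least)

lemma hilbert_value_le_modules:
  assumes y: "\<And>i. i \<in> {1..k} \<Longrightarrow> y i \<in> restrict_supp (V i) M \<and> y i \<noteq> 0"
  shows "hilbert_value k y \<le> hilbert_value_modules k (\<lambda>i. restrict_supp (V i) M)"
proof -
  let ?D = "{hilbert_value k x | x. \<forall>i\<in>{1..k}. x i \<in> restrict_supp (V i) M \<and> x i \<noteq> 0}"
  \<comment> \<open>The projectors decrease \<open>e\<close>, so it satisfies the comparison
    hypothesis with factor \<open>1\<close>. This bounds the set \<open>?D\<close>, as the real
    supremum requires.\<close>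
  define e :: "real ^ 'n" where "e = indicator_vec M"
  have e: "0 \<le> e" "vsupp e = M" by (simp_all add: e_def)
  then have "hilbert_value k x \<le> 1"
    if "\<forall>i\<in>{1..k}. x i \<in> restrict_supp (V i) M \<and> x i \<noteq> 0" for x
    using that cyclic_projector_le[of k e] by (intro hilbert_value_le[of e]) auto
  then have "bdd_above ?D" by (auto intro!: bdd_aboveI[of _ 1])
  moreover have "hilbert_value k y \<in> ?D" using y by blast
  ultimately show ?thesis
    unfolding hilbert_value_modules_def Let_def by (auto intro: cSup_upper)
qed

lemma hilbert_value_modules_nonneg:
  "0 \<le> hilbert_value_modules k (\<lambda>i. restrict_supp (V i) M)"
proof (cases "\<exists>y. \<forall>i\<in>{1..k}. y i \<in> restrict_supp (V i) M \<and> y i \<noteq> 0")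
  case True
  then obtain y where y: "\<forall>i\<in>{1..k}. y i \<in> restrict_supp (V i) M \<and> y i \<noteq> 0" ..
  then have "0 \<le> hilbert_value k y"
    by (intro hilbert_value_nonneg) (auto simp: restrict_supp_def)
  also have "\<dots> \<le> hilbert_value_modules k (\<lambda>i. restrict_supp (V i) M)"
    using y by (intro hilbert_value_le_modules) auto
  finally show ?thesis .
next
  case False
  then show ?thesis by (auto simp: hilbert_value_modules_def Let_def)
qed

text \<open>The successive projections of \<open>x\<close> form the witness tuple. They decrease, so
  all quotients but the closing one are at least \<open>1\<close>; the closing one is at least
  \<open>l\<close>, since the last projection is \<open>l x\<close> and the first lies below
  \<open>x\<close>. Allowing \<open>M\<close> to exceed the support of \<open>x\<close> matters for
  limits of eigenvectors, whose support may shrink.\<close>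

lemma eigenvalue_le_hilbert_value_modules:
  assumes x: "0 \<le> x" "x \<noteq> 0" "vsupp x \<subseteq> M" "cyclic_projector V k x = l *\<^sub>R x" and l: "0 \<le> l"
  shows "l \<le> hilbert_value_modules k (\<lambda>i. restrict_supp (V i) M)"
\<comment> \<open>For \<open>l = 0\<close> the last projection vanishes, so the tuple below would
  not be admissible.\<close>
proof (cases "l = 0")
  case True
  then show ?thesis by (simp add: hilbert_value_modules_nonneg)
next
  case False
  define y where "y = (\<lambda>i. cyclic_projector V i x)"
  have y0: "0 \<le> y i" if "i \<in> {1..k}" for i
    using that x by (auto simp: y_def intro!: cyclic_projector_nonneg)
  have yk: "y k = l *\<^sub>R x" by (simp add: y_def x)
  have yV: "y i \<in> restrict_supp (V i) M \<and> y i \<noteq> 0" if i: "i \<in> {1..k}" for i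
  proof -
    \<comment> \<open>Every projection dominates the last one, which is nonzero.\<close>
    have "l *\<^sub>R x \<le> y i"
      using i x cyclic_projector_antimono[of i k x] by (simp add: y_def)
    then have "y i \<noteq> 0"
      using False l x scaleR_vec_mono[of l 0 x] by (metis antisym scaleR_eq_0_iff scaleR_zero_right)
    moreover have "vsupp (y i) \<subseteq> M"
      using i x y0[OF i] vsupp_mono[of "y i" x] cyclic_projector_le[of i x] by (auto simp: y_def)
    ultimately show ?thesis
      using cyclic_projector_in[OF i x(1)] by (simp add: restrict_supp_def y_def)
  qed
  have "1 \<le> (\<Prod>i\<in>{1..<k}. vquot (y i) (y (Suc i)))"
  proof (rule prod_ge_1)
    fix i assume "i \<in> {1..<k}"
    then show "1 \<le> vquot (y i) (y (Suc i))"
      using yV y0 x cyclic_projector_Suc_le[of i x] by (intro le_vquot) (auto simp: y_def simp del: cyclic_projector.simps)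
  qed
  moreover have "l \<le> vquot (y k) (y 1)"
  proof (rule le_vquot)
    show "l *\<^sub>R y 1 \<le> y k"
      unfolding yk using l x k by (intro scaleR_vec_mono) (simp_all add: y_def cyclic_projector_le del: cyclic_projector.simps One_nat_def)
  qed (use y0 yV k in auto)
  ultimately have "1 * l \<le> hilbert_value k y"
    unfolding hilbert_value_def using l by (intro mult_mono) auto
  also have "\<dots> \<le> hilbert_value_modules k (\<lambda>i. restrict_supp (V i) M)"
    using yV by (rule hilbert_value_le_modules)
  finally show ?thesis by simp
qed

lemma eigenvalue_eq_hilbert_value_modules:
  assumes "0 \<le> x" "x \<noteq> 0" "cyclic_projector V k x = l *\<^sub>R x" "0 \<le> l"
  shows "l = hilbert_value_modules k (\<lambda>i. restrict_supp (V i) (vsupp x))"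
  using assms by (intro antisym hilbert_value_modules_le eigenvalue_le_hilbert_value_modules) auto

subsection \<open>Existence of eigenvectors\<close>

lemma cyclic_projector_vsupp:
  assumes "0 \<le> x"
  shows "vsupp (cyclic_projector V k x) \<subseteq> vsupp x"
  using assms by (intro vsupp_mono cyclic_projector_nonneg cyclic_projector_le) auto

text \<open>Brouwer's theorem applies to \<open>G e\<close> divided by its coordinate sum. The
  perturbation keeps this sum positive even where the cyclic projector vanishes; a fixed point is an
  eigenvector with the sum as eigenvalue.\<close>

lemma perturbed_eigenvector:
  fixes M :: "'n set"
  defines "G \<equiv> \<lambda>e x. cyclic_projector V k x + e *\<^sub>R indicator_vec M"
  assumes M: "M \<noteq> {}" and e: "0 < e"
  obtains x where "x \<in> simplex_face M" "G e x = (\<Sum>i\<in>UNIV. G e x $ i) *\<^sub>R x"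
proof -
  let ?S = "simplex_face M"
  define s where "s = (\<lambda>x. \<Sum>i\<in>UNIV. G e x $ i)"
  obtain j where j: "j \<in> M" using M by blast
  have F: "0 \<le> cyclic_projector V k x" "vsupp (cyclic_projector V k x) \<subseteq> M" if "x \<in> ?S" for x
    using that cyclic_projector_nonneg[of k x] cyclic_projector_vsupp[of x]
    by (auto simp: simplex_face_def)
  have G0: "0 \<le> G e x $ i" if "x \<in> ?S" for x i
    using F[OF that] e by (simp add: G_def less_eq_vec_def indicator_vec_def)
  have s: "0 < s x" if "x \<in> ?S" for x
    unfolding s_def using G0[OF that] F[OF that] j e
    by (intro sum_pos2[of UNIV j]) (auto simp: G_def indicator_vec_def less_eq_vec_def add_nonneg_pos)
  have "continuous_on ?S (cyclic_projector V k)"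
    using continuous_on_subset[OF continuous_on_cyclic_projector simplex_face_subset] by simp
  then have contG: "continuous_on ?S (G e)"
    unfolding G_def by (intro continuous_intros)
  have "continuous_on ?S (\<lambda>x. (1 / s x) *\<^sub>R G e x)"
    using s contG unfolding s_def by (intro continuous_intros) force+
  moreover have "(1 / s x) *\<^sub>R G e x \<in> ?S" if x: "x \<in> ?S" for x
  proof -
    have "(\<Sum>i\<in>UNIV. ((1 / s x) *\<^sub>R G e x) $ i) = (1 / s x) * s x"
      unfolding s_def sum_distrib_left by simp
    moreover have "G e x $ i = 0" if "i \<notin> M" for i
      using F[OF x] that by (auto simp: G_def vsupp_def indicator_vec_def)
    ultimately show ?thesis
      using s[OF x] G0[OF x] by (auto simp: simplex_face_def less_eq_vec_def vsupp_def)
  qed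
  ultimately obtain x where x: "x \<in> ?S" "(1 / s x) *\<^sub>R G e x = x"
    using brouwer[OF compact_simplex_face convex_simplex_face, of M "\<lambda>x. (1 / s x) *\<^sub>R G e x"]
      axis_in_simplex_face[OF j] by blast
  have "G e x = s x *\<^sub>R ((1 / s x) *\<^sub>R G e x)"
    using s[OF x(1)] by simp
  then have "G e x = s x *\<^sub>R x" unfolding x(2) .
  with x show thesis unfolding s_def by (intro that)
qed

lemma hilbert_value_modules_eigenvector:
  assumes M: "M \<noteq> {}"
  obtains x where "0 \<le> x" "x \<noteq> 0"
    "cyclic_projector V k x = hilbert_value_modules k (\<lambda>i. restrict_supp (V i) M) *\<^sub>R x"
proof -
  let ?S = "simplex_face M"
  let ?F = "cyclic_projector V k"
  let ?d = "hilbert_value_modules k (\<lambda>i. restrict_supp (V i) M)"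
  define e where "e = (\<lambda>n. inverse (real (Suc n)))"
  define G where "G = (\<lambda>n x. ?F x + e n *\<^sub>R indicator_vec M)"
  have e: "0 < e n" for n by (simp add: e_def)
  have "\<exists>x\<in>?S. G n x = (\<Sum>i\<in>UNIV. G n x $ i) *\<^sub>R x" for n
    using perturbed_eigenvector[OF M e[of n]] unfolding G_def by metis
  then obtain X where X: "\<And>n. X n \<in> ?S" "\<And>n. G n (X n) = (\<Sum>i\<in>UNIV. G n (X n) $ i) *\<^sub>R X n"
    by metis
  define l where "l = (\<lambda>n. \<Sum>i\<in>UNIV. G n (X n) $ i)"
  have X0: "0 \<le> X n" "vsupp (X n) \<subseteq> M" for n using X(1)[of n] by (auto simp: simplex_face_def)
  have FX0: "0 \<le> ?F (X n)" for n using X0 by (intro cyclic_projector_nonneg) auto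
  have G0: "0 \<le> G n (X n)" and FG: "?F (X n) \<le> G n (X n)" for n
    using FX0[of n] e[of n] by (auto simp: G_def less_eq_vec_def indicator_vec_def)
  have GX: "G n (X n) = l n *\<^sub>R X n" for n using X(2) by (simp add: l_def)
  have l0: "0 \<le> l n" for n
    using G0[of n] by (auto simp: l_def less_eq_vec_def intro: sum_nonneg)
  \<comment> \<open>The perturbation makes \<open>G n (X n)\<close> positive on \<open>M\<close>,
    and this vector is a multiple of \<open>X n\<close>.\<close>
  have "M \<subseteq> vsupp (X n)" for n
  proof
    fix i assume "i \<in> M"
    then have "0 < G n (X n) $ i"
      using FX0[of n] e[of n] by (simp add: G_def indicator_vec_def less_eq_vec_def add_nonneg_pos)
    then show "i \<in> vsupp (X n)" unfolding GX by (auto simp: vsupp_def)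
  qed
  then have supp: "vsupp (X n) = M" for n using X0 by blast
  \<comment> \<open>Dropping the perturbation turns the equation into
    \<open>?F (X n) \<le> l n *\<^sub>R X n\<close>, and full support makes the upper bound apply to
    all of \<open>M\<close>.\<close>
  have d_le: "?d \<le> l n" for n
    using hilbert_value_modules_le[of "X n" "l n"] X0[of n] FG[of n] l0[of n] by (simp add: supp GX)
  obtain x r where x: "x \<in> ?S" and r: "strict_mono r" and lim: "(X \<circ> r) \<longlonglongrightarrow> x"
    using compact_simplex_face[of M] X(1) unfolding compact_def by blast
  have x0: "0 \<le> x" "vsupp x \<subseteq> M" using x by (auto simp: simplex_face_def)
  have "continuous_on ?S ?F"
    using continuous_on_subset[OF continuous_on_cyclic_projector simplex_face_subset] by simp
  then have Flim: "(\<lambda>n. ?F (X (r n))) \<longlonglongrightarrow> ?F x"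
    using lim x X(1) by (auto simp: continuous_on_sequentially o_def)
  have "(\<lambda>n. e (r n)) \<longlonglongrightarrow> 0"
    using LIMSEQ_subseq_LIMSEQ[OF LIMSEQ_inverse_real_of_nat r] by (simp add: e_def o_def)
  with Flim have "(\<lambda>n. G (r n) (X (r n))) \<longlonglongrightarrow> ?F x + 0 *\<^sub>R indicator_vec M"
    unfolding G_def by (intro tendsto_intros)
  then have Glim: "(\<lambda>n. G (r n) (X (r n))) \<longlonglongrightarrow> ?F x" by simp
  \<comment> \<open>Each \<open>l n\<close> is a coordinate sum of \<open>G n (X n)\<close>, so its
    limit along \<open>r\<close> is the coordinate sum of the limit vector.\<close>
  define c where "c = (\<Sum>i\<in>UNIV. ?F x $ i)"
  have llim: "(\<lambda>n. l (r n)) \<longlonglongrightarrow> c"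
    unfolding l_def c_def by (intro tendsto_intros Glim)
  have "(\<lambda>n. G (r n) (X (r n))) \<longlonglongrightarrow> c *\<^sub>R x"
    unfolding GX using llim lim by (auto intro: tendsto_scaleR simp: o_def)
  with Glim have Fx: "?F x = c *\<^sub>R x" by (rule LIMSEQ_unique)
  \<comment> \<open>The lower bound on \<open>c\<close> comes from the perturbed problems, the upper
    bound from the eigenvector \<open>x\<close> itself.\<close>
  have "?d \<le> c" using llim d_le by (auto intro: LIMSEQ_le_const)
  moreover have "0 \<le> c"
    using llim l0 by (auto intro: LIMSEQ_le_const)
  then have "c \<le> ?d"
    using x0 simplex_face_nonzero[OF x] Fx by (intro eigenvalue_le_hilbert_value_modules)
  ultimately show thesis
    using that[of x] x0 simplex_face_nonzero[OF x] Fx by simp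
qed

section \<open>The spectrum and the spectral radius\<close>

lemma spectrum_cyclic_projector:
  "spectrum (cyclic_projector V k) =
    {hilbert_value_modules k (\<lambda>i. restrict_supp (V i) M) | M. M \<noteq> {}}"
proof (intro equalityI subsetI)
  fix c assume "c \<in> spectrum (cyclic_projector V k)"
  then obtain x where x: "0 \<le> x" "x \<noteq> 0" "cyclic_projector V k x = c *\<^sub>R x" "0 \<le> c"
    by (auto simp: spectrum_def nonneg_orthant_def)
  moreover from x(2) have "vsupp x \<noteq> {}" by (auto simp: vsupp_def vec_eq_iff)
  ultimately show "c \<in> {hilbert_value_modules k (\<lambda>i. restrict_supp (V i) M) | M. M \<noteq> {}}"
    using eigenvalue_eq_hilbert_value_modules[OF x] by blast
next
  fix c assume "c \<in> {hilbert_value_modules k (\<lambda>i. restrict_supp (V i) M) | M. M \<noteq> {}}"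
  then obtain M where M: "M \<noteq> {}" "c = hilbert_value_modules k (\<lambda>i. restrict_supp (V i) M)" by blast
  then show "c \<in> spectrum (cyclic_projector V k)"
    using hilbert_value_modules_eigenvector[OF M(1)] hilbert_value_modules_nonneg[of M]
    unfolding spectrum_def nonneg_orthant_def by blast
qed

text \<open>Choosing all coordinates for \<open>M\<close> removes the support restriction: the
  Hilbert value is then an eigenvalue, and it bounds every other one.\<close>

lemma is_spectral_radius_cyclic_projector:
  "is_spectral_radius (cyclic_projector V k) (hilbert_value_modules k V)"
proof -
  have UNIV: "(\<lambda>i. restrict_supp (V i) UNIV) = V" by (simp add: restrict_supp_def)
  have "hilbert_value_modules k V \<in> spectrum (cyclic_projector V k)"
    unfolding spectrum_cyclic_projector by (auto simp: UNIV intro!: exI[of _ UNIV])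
  moreover have "c \<le> hilbert_value_modules k V" if "c \<in> spectrum (cyclic_projector V k)" for c
    using that eigenvalue_le_hilbert_value_modules[of _ UNIV c]
    by (auto simp: spectrum_def nonneg_orthant_def UNIV)
  ultimately show ?thesis by (simp add: is_spectral_radius_def)
qed

end

theorem theorem18:
  fixes V :: "nat \<Rightarrow> (real ^ 'n) set" and k :: nat
  assumes "1 \<le> k"
    and "\<And>i. i \<in> {1..k} \<Longrightarrow> subsemimodule (V i)"
    and "\<And>i. i \<in> {1..k} \<Longrightarrow> closed (V i)"
  shows "is_spectral_radius (cyclic_projector V k) (hilbert_value_modules k V) \<and>
         spectrum (cyclic_projector V k) =
           {hilbert_value_modules k (\<lambda>i. restrict_supp (V i) M) | M. M \<noteq> {}}"
proof -
  interpret closed_subsemimodules V k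
    using assms by unfold_locales
  show ?thesis
    using is_spectral_radius_cyclic_projector spectrum_cyclic_projector by blast
qed

end
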